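(* Let $C\subseteq\mathbb{F}_2^n$ be a binary linear $[n,k,d]$ code with $\mathbf{1}_n\in C$, whose dual $C^\perp$ has minimum distance $d^\perp$, and let $t$ be a positive integer such that $$d^\perp-t=\#\{u \mid C_u\neq\emptyset,\ 0<u\le n-t\}.$$ Let $w\ge 0$ be an integer. (1) Suppose $(d^\perp,t)=(4,2)$. If $$\sum_{i=0}^{w}(-1)^{w-i}\binom{d-3}{w-i}\binom{n-2d}{2i+1}=0,$$ then $D^\perp_{2w+4}$ is a $3$-design. (2) Suppose $(d^\perp,t)=(4,1)$ or $(6,3)$. If $$\left(\sum_{i=0}^{w}(-1)^{w-i}\binom{d-(t+1)}{w-i}\binom{n-2d}{2i}\right)+(-1)^{w+1}\binom{n/2-(t+1)}{w}=0,$$ then $D^\perp_{2w+t+1}$ is a $(t+1)$-design.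
   Context: $\mathbf{1}_n$ is the all-ones vector; $C^\perp$ is the dual code with respect to the standard inner product, with minimum nonzero weight $d^\perp$; $C_u=\{c\in C:\mathrm{wt}(c)=u\}$ (Hamming weight). A $t$-design on point set $X$ is a collection of blocks ($k$-subsets of $X$) such that every $t$-subset of $X$ lies in the same number $\lambda$ of blocks. $D^\perp_w$ denotes the support design of $C^\perp$ for weight $w$: point set $\{1,\dots,n\}$, blocks the supports $\{i: c_i\ne 0\}$ of the codewords $c\in C^\perp$ of weight $w$. *)

theory Defs
  imports Complex_Main
begin

text \<open>Binary vectors of length n: functions nat => bool (True = 1 in F_2), zero outside {0..<n}.\<close>

definition bvecs :: "nat \<Rightarrow> (nat \<Rightarrow> bool) set" where
  "bvecs n = {v. \<forall>i\<ge>n. \<not> v i}"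

definition bzero :: "nat \<Rightarrow> bool" where
  "bzero = (\<lambda>i. False)"

definition ones :: "nat \<Rightarrow> nat \<Rightarrow> bool" where
  "ones n = (\<lambda>i. i < n)"

definition badd :: "(nat \<Rightarrow> bool) \<Rightarrow> (nat \<Rightarrow> bool) \<Rightarrow> nat \<Rightarrow> bool" where
  "badd u v = (\<lambda>i. u i \<noteq> v i)"

text \<open>Binary linear code of length n: an F_2-subspace of F_2^n
  (scalar multiplication over F_2 is trivial, so: contains 0 and closed under addition).\<close>
definition binary_linear_code :: "nat \<Rightarrow> (nat \<Rightarrow> bool) set \<Rightarrow> bool" where
  "binary_linear_code n C \<longleftrightarrow> C \<subseteq> bvecs n \<and> bzero \<in> C \<and> (\<forall>u\<in>C. \<forall>v\<in>C. badd u v \<in> C)"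

definition supp :: "nat \<Rightarrow> (nat \<Rightarrow> bool) \<Rightarrow> nat set" where
  "supp n v = {i. i < n \<and> v i}"

definition wt :: "nat \<Rightarrow> (nat \<Rightarrow> bool) \<Rightarrow> nat" where
  "wt n v = card (supp n v)"

text \<open>Standard inner product over F_2 is zero iff the number of common 1-positions is even.\<close>
definition orth :: "nat \<Rightarrow> (nat \<Rightarrow> bool) \<Rightarrow> (nat \<Rightarrow> bool) \<Rightarrow> bool" where
  "orth n u v \<longleftrightarrow> even (card {i. i < n \<and> u i \<and> v i})"

definition dual_code :: "nat \<Rightarrow> (nat \<Rightarrow> bool) set \<Rightarrow> (nat \<Rightarrow> bool) set" where
  "dual_code n C = {v \<in> bvecs n. \<forall>c\<in>C. orth n c v}"

text \<open>Minimum (nonzero) weight = minimum distance of a linear code.\<close>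
definition min_dist :: "nat \<Rightarrow> (nat \<Rightarrow> bool) set \<Rightarrow> nat" where
  "min_dist n C = Min {wt n c | c. c \<in> C \<and> c \<noteq> bzero}"

definition weight_class :: "nat \<Rightarrow> (nat \<Rightarrow> bool) set \<Rightarrow> nat \<Rightarrow> (nat \<Rightarrow> bool) set" where
  "weight_class n C u = {c \<in> C. wt n c = u}"

definition is_t_design :: "nat set \<Rightarrow> nat set set \<Rightarrow> nat \<Rightarrow> bool" where
  "is_t_design X B t \<longleftrightarrow> (\<forall>b\<in>B. b \<subseteq> X) \<and> (\<exists>k. \<forall>b\<in>B. card b = k) \<and>
     (\<exists>lam::nat. \<forall>T. T \<subseteq> X \<and> card T = t \<longrightarrow> card {b\<in>B. T \<subseteq> b} = lam)"

definition support_blocks :: "nat \<Rightarrow> (nat \<Rightarrow> bool) set \<Rightarrow> nat \<Rightarrow> nat set set" where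
  "support_blocks n C w = supp n ` weight_class n C w"

end

theory Submission
  imports Defs "HOL-Computational_Algebra.Formal_Power_Series"
begin

unbundle fps_syntax

text \<open>
  Codewords are replaced by their supports. For \<open>s\<close>-subsets \<open>T\<close>, \<open>T'\<close> of the coordinates let
  \<open>\<delta> u\<close> be the difference of the numbers of codewords of weight \<open>u\<close> through \<open>T\<close> and through
  \<open>T'\<close>. Any fewer than \<open>d\<^sup>\<bottom>\<close> coordinates of the code are independent, so the binomial moments
  \<open>\<Sum>u. \<delta> u * (u - s choose m)\<close> vanish for \<open>s + m < d\<^sup>\<bottom>\<close>; for \<open>s \<le> t\<close> there are at
  least as many such equations as relevant weights, hence \<open>\<delta> = 0\<close> (Assmus and Mattson).

  For \<open>s = t + 1\<close>, complementation gives \<open>\<delta> (n - u) = (-1)\<^sup>s \<delta> u\<close>, and MacWilliams duality shows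
  that the corresponding differences for the dual code are, up to a nonzero factor, the coefficients of
  \<open>\<Sum>u. \<delta> u * (1 - x)\<^bsup>u - s\<^esup> * (1 + x)\<^bsup>n - u - s\<^esup>\<close>. In the cases of the theorem \<open>\<delta>\<close> is
  supported on \<open>{d, n - d}\<close> (\<open>s\<close> odd), or is zero or proportional to \<open>1, -2, 1\<close> at
  \<open>d, n/2, n - d\<close> (\<open>s\<close> even, since \<open>\<Sum>u. \<delta> u = 0\<close>), so that the coefficient in question is a
  multiple of the sum assumed to be zero.
\<close>

section \<open>Sums over subsets\<close>

definition blocks_through :: "'a set set \<Rightarrow> nat \<Rightarrow> 'a set \<Rightarrow> nat" where
  "blocks_through F u T = card {A \<in> F. card A = u \<and> T \<subseteq> A}"

definition block_diff :: "'a set set \<Rightarrow> 'a set \<Rightarrow> 'a set \<Rightarrow> nat \<Rightarrow> real" where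
  "block_diff F T T' u = real (blocks_through F u T) - real (blocks_through F u T')"

text \<open>Orthogonality read on supports: the parity of \<open>card (A \<inter> B)\<close> is the
  inner product of the two indicator vectors over the field with two elements.\<close>

definition dual_family :: "'a set \<Rightarrow> 'a set set \<Rightarrow> 'a set set" where
  "dual_family V F = {B. B \<subseteq> V \<and> (\<forall>A\<in>F. even (card (A \<inter> B)))}"

text \<open>
  The moments kill every polynomial of degree below \<open>M\<close> in \<open>u\<close>, in particular the product of the
  \<open>u - r\<close> over all \<open>r \<in> S\<close> other than \<open>v\<close>.
\<close>
lemma vanishing_if_binomial_moments_vanish:
  fixes f :: "nat \<Rightarrow> real"
  assumes "finite S" "card S \<le> M"
    and ge: "\<And>u. u \<in> S \<Longrightarrow> s \<le> u"
    and moment: "\<And>m. m < M \<Longrightarrow> (\<Sum>u\<in>S. f u * real ((u - s) choose m)) = 0"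
    and "v \<in> S"
  shows "f v = 0"
proof -
  \<comment> \<open>The extra binomial factor keeps the induction on \<open>R\<close> going: each
    factor \<open>u - r\<close> may raise the index \<open>m\<close> by one, hence the budget
    \<open>card R + m < M\<close>.\<close>
  have products: "(\<Sum>u\<in>S. f u * (\<Prod>r\<in>R. real u - real r) * real ((u - s) choose m)) = 0"
    if "finite R" "card R + m < M" for R :: "nat set" and m
    using that
  proof (induction R arbitrary: m rule: finite_induct)
    case empty
    then show ?case using moment by simp
  next
    case (insert r R)
    \<comment> \<open>Split \<open>u - r\<close> as \<open>(u - s - m) + (m + s - r)\<close> and
      absorb the first summand into the binomial.\<close>
    have step: "(real u - real r) * real ((u - s) choose m) =
        real (m + 1) * real ((u - s) choose (m + 1)) + (real (m + s) - real r) * real ((u - s) choose m)"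
      if "u \<in> S" for u
    proof -
      have "Suc m * ((u - s) choose Suc m) = (u - s - m) * ((u - s) choose m)"
        by (metis binomial_absorb_comp binomial_absorption mult.commute)
      \<comment> \<open>For \<open>m > u - s\<close> the subtraction truncates, but then the
        binomial is zero on both sides.\<close>
      moreover have "real ((u - s - m) * ((u - s) choose m)) = (real u - real s - real m) * real ((u - s) choose m)"
        using ge[OF that] by (cases "m \<le> u - s") (simp_all add: of_nat_diff binomial_eq_0)
      ultimately have "real (m + 1) * real ((u - s) choose (m + 1)) = (real u - real s - real m) * real ((u - s) choose m)"
        by (metis Suc_eq_plus1 of_nat_mult)
      then show ?thesis by (simp add: algebra_simps)
    qed
    have "(\<Sum>u\<in>S. f u * (\<Prod>r\<in>insert r R. real u - real r) * real ((u - s) choose m)) =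
        (\<Sum>u\<in>S. real (m + 1) * (f u * (\<Prod>r\<in>R. real u - real r) * real ((u - s) choose (m + 1)))
          + (real (m + s) - real r) * (f u * (\<Prod>r\<in>R. real u - real r) * real ((u - s) choose m)))"
    proof (rule sum.cong)
      fix u assume u: "u \<in> S"
      have "f u * (\<Prod>r\<in>insert r R. real u - real r) * real ((u - s) choose m) =
          f u * (\<Prod>r\<in>R. real u - real r) * ((real u - real r) * real ((u - s) choose m))"
        using insert.hyps by simp
      then show "f u * (\<Prod>r\<in>insert r R. real u - real r) * real ((u - s) choose m) =
          real (m + 1) * (f u * (\<Prod>r\<in>R. real u - real r) * real ((u - s) choose (m + 1)))
          + (real (m + s) - real r) * (f u * (\<Prod>r\<in>R. real u - real r) * real ((u - s) choose m))"
        unfolding step[OF u] by (simp only: algebra_simps)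
    qed simp
    also have "\<dots> = 0"
      using insert.IH[of "m + 1"] insert.IH[of m] insert.prems insert.hyps
      by (simp add: sum.distrib flip: sum_distrib_left)
    finally show ?case .
  qed
  have "card (S - {v}) + 0 < M"
    using assms by (metis add.right_neutral card_Diff1_less less_le_trans)
  then have "0 = (\<Sum>u\<in>S. f u * (\<Prod>r\<in>S - {v}. real u - real r))"
    using products[of "S - {v}" 0] assms(1) by simp
  also have "\<dots> = (\<Sum>u\<in>S. if u = v then f u * (\<Prod>r\<in>S - {v}. real u - real r) else 0)"
    using assms(1) by (intro sum.cong) (auto intro: prod_zero)
  also have "\<dots> = f v * (\<Prod>r\<in>S - {v}. real v - real r)"
    using assms by simp
  finally show ?thesis using assms(1) by auto
qed

text \<open>Binomial theorem over the subsets of \<open>K\<close>, padded to total degree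
  \<open>card T\<close>. With \<open>K = A \<inter> T\<close> it turns a quantity depending on
  \<open>card (A \<inter> T)\<close> into a sum over those \<open>I \<subseteq> T\<close> that lie
  in \<open>A\<close>, hence into numbers of codewords through \<open>I\<close>.\<close>

lemma sum_Pow_power:
  fixes a b :: "'c :: comm_ring_1"
  assumes "finite T" "K \<subseteq> T"
  shows "(\<Sum>I\<in>Pow K. a ^ card I * b ^ (card T - card I)) = (a + b) ^ card K * b ^ (card T - card K)"
proof -
  have fin: "finite K" using assms finite_subset by blast
  have "(a + b) ^ card K = (\<Sum>I\<in>Pow K. a ^ card I * b ^ card (K - I))"
    using prod_add[OF fin, of "\<lambda>_. a" "\<lambda>_. b"] by simp
  then have "(a + b) ^ card K * b ^ (card T - card K)
      = (\<Sum>I\<in>Pow K. a ^ card I * (b ^ card (K - I) * b ^ (card T - card K)))"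
    by (simp add: sum_distrib_right mult.assoc)
  also have "\<dots> = (\<Sum>I\<in>Pow K. a ^ card I * b ^ (card T - card I))"
  proof (rule sum.cong)
    fix I assume I: "I \<in> Pow K"
    then have "card I \<le> card K" "card K \<le> card T" "card (K - I) = card K - card I"
      using assms fin by (auto intro: card_mono simp: card_Diff_subset finite_subset)
    then show "a ^ card I * (b ^ card (K - I) * b ^ (card T - card K)) = a ^ card I * b ^ (card T - card I)"
      by (simp flip: power_add)
  qed simp
  finally show ?thesis by simp
qed

text \<open>Each coordinate of \<open>W\<close> contributes independently, \<open>1 - x\<close>
  inside \<open>A\<close> and \<open>1 + x\<close> outside; multiplying out gives the sum over
  subsets. This is the kernel of the MacWilliams transform, and at \<open>x = -1\<close> it is
  \<open>2 ^ card W\<close> times the indicator of \<open>W \<subseteq> A\<close>.\<close>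

lemma sum_Pow_signed_power:
  fixes x :: "'c :: comm_ring_1"
  assumes "finite W"
  shows "(\<Sum>D\<in>Pow W. (-1) ^ card (A \<inter> D) * x ^ card D) = (1 - x) ^ card (A \<inter> W) * (1 + x) ^ card (W - A)"
proof -
  have *: "(\<Prod>i\<in>D. if i \<in> A then - x else x) = (-1) ^ card (A \<inter> D) * x ^ card D"
    if "finite D" for D
  proof -
    have "(\<Prod>i\<in>D. if i \<in> A then - x else x) = (\<Prod>i\<in>D. (if i \<in> A then - 1 else 1) * x)"
      by (intro prod.cong) auto
    also have "\<dots> = (\<Prod>i\<in>D. if i \<in> A then - 1 else 1) * x ^ card D"
      by (simp add: prod.distrib)
    also have "(\<Prod>i\<in>D. if i \<in> A then - 1 else 1 :: 'c) = (-1) ^ card (A \<inter> D)"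
      using that by (simp add: prod.If_cases Int_commute)
    finally show ?thesis .
  qed
  have "(\<Sum>D\<in>Pow W. (-1) ^ card (A \<inter> D) * x ^ card D) = (\<Prod>i\<in>W. (if i \<in> A then - x else x) + 1)"
    unfolding prod_add[OF assms] using assms
    by (intro sum.cong) (auto simp: * finite_subset)
  also have "\<dots> = (\<Prod>i\<in>W. if i \<in> A then 1 - x else 1 + x)"
    by (intro prod.cong) auto
  also have "\<dots> = (1 - x) ^ card (A \<inter> W) * (1 + x) ^ card (W - A)"
    using assms by (simp add: prod.If_cases Int_commute Diff_eq)
  finally show ?thesis .
qed

lemma sum_card_eq_blocks_through:
  fixes g :: "nat \<Rightarrow> 'c :: comm_semiring_1"
  assumes "finite F" "\<And>A. A \<in> F \<Longrightarrow> card A \<le> n"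
  shows "(\<Sum>A | A \<in> F \<and> T \<subseteq> A. g (card A)) = (\<Sum>u\<le>n. of_nat (blocks_through F u T) * g u)"
proof -
  have "(\<Sum>A | A \<in> F \<and> T \<subseteq> A. g (card A))
      = (\<Sum>u\<le>n. \<Sum>A | A \<in> {A \<in> F. T \<subseteq> A} \<and> card A = u. g (card A))"
    using assms by (subst sum.group) auto
  also have "\<dots> = (\<Sum>u\<le>n. of_nat (blocks_through F u T) * g u)"
    by (intro sum.cong) (auto simp: blocks_through_def conj_ac)
  finally show ?thesis .
qed

text \<open>A bijection from \<open>T\<close> to \<open>T'\<close> pairs their subsets with equal
  cardinalities, so the proper subsets cancel and only the top term survives.\<close>

lemma sum_Pow_diff:
  fixes c :: "nat \<Rightarrow> 'c :: comm_ring_1"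
  assumes "finite T" "finite T'" "card T' = card T"
    and smaller: "\<And>I I'. I \<subseteq> T \<Longrightarrow> I' \<subseteq> T' \<Longrightarrow> card I' = card I \<Longrightarrow> card I < card T \<Longrightarrow> g I = g I'"
  shows "(\<Sum>I\<in>Pow T. c (card I) * g I) - (\<Sum>I\<in>Pow T'. c (card I) * g I) = c (card T) * (g T - g T')"
proof -
  obtain h where h: "bij_betw h T T'"
    using assms by (metis finite_same_card_bij)
  have card_image: "card (h ` I) = card I" if "I \<subseteq> T" for I
    using that h by (meson bij_betw_imp_inj_on card_image inj_on_subset)
  have "bij_betw ((`) h) (Pow T) (Pow T')"
    using h by (rule bij_betw_Pow)
  then have "(\<Sum>I\<in>Pow T'. c (card I) * g I) = (\<Sum>I\<in>Pow T. c (card (h ` I)) * g (h ` I))"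
    by (rule sum.reindex_bij_betw[symmetric])
  then have "(\<Sum>I\<in>Pow T. c (card I) * g I) - (\<Sum>I\<in>Pow T'. c (card I) * g I)
      = (\<Sum>I\<in>Pow T. c (card I) * (g I - g (h ` I)))"
    by (simp add: card_image algebra_simps sum_subtractf)
  also have "\<dots> = (\<Sum>I\<in>Pow T. if I = T then c (card T) * (g T - g T') else 0)"
  proof (rule sum.cong)
    fix I assume I: "I \<in> Pow T"
    have "g I = g (h ` I)" if "I \<noteq> T"
      using that I h assms(1) smaller[of I "h ` I"]
      by (auto simp: card_image bij_betw_def intro: psubset_card_mono)
    then show "c (card I) * (g I - g (h ` I)) = (if I = T then c (card T) * (g T - g T') else 0)"
      using h by (auto simp: bij_betw_def)
  qed simp
  also have "\<dots> = c (card T) * (g T - g T')"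
    using assms(1) by simp
  finally show ?thesis .
qed

section \<open>Binary codes as families of sets\<close>

text \<open>A binary code with the all-ones word, seen through supports: addition of vectors becomes
  symmetric difference.\<close>

locale binary_code =
  fixes V :: "'a set" and F :: "'a set set"
  assumes finite_V: "finite V"
    and F_subset: "A \<in> F \<Longrightarrow> A \<subseteq> V"
    and empty_in: "{} \<in> F"
    and full_in: "V \<in> F"
    and sym_diff_in: "A \<in> F \<Longrightarrow> B \<in> F \<Longrightarrow> sym_diff A B \<in> F"
begin

abbreviation "n \<equiv> card V"
abbreviation "D \<equiv> dual_family V F"

text \<open>This is the hypothesis under which \<open>sum_Pow_diff\<close> isolates the top term
  when the summands are counts of codewords through \<open>I\<close>.\<close>

definition designs_below :: "nat \<Rightarrow> bool" where
  "designs_below s \<longleftrightarrow> (\<forall>I I' u. I \<subseteq> V \<longrightarrow> I' \<subseteq> V \<longrightarrow> card I' = card I \<longrightarrow> card I < s \<longrightarrow>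
    blocks_through F u I = blocks_through F u I')"

lemma designs_belowD:
  "designs_below s \<Longrightarrow> I \<subseteq> V \<Longrightarrow> I' \<subseteq> V \<Longrightarrow> card I' = card I \<Longrightarrow> card I < s \<Longrightarrow>
    blocks_through F u I = blocks_through F u I'"
  unfolding designs_below_def by blast

lemma finite_F [simp]: "finite F"
  using finite_V F_subset by (auto intro: finite_subset[of F "Pow V"])

lemma finite_D [simp]: "finite D"
  using finite_V by (auto simp: dual_family_def intro: finite_subset[of _ "Pow V"])

lemma finite_member: "A \<in> F \<Longrightarrow> finite A"
  using finite_V F_subset finite_subset by blast

lemma card_le: "A \<in> F \<Longrightarrow> card A \<le> n"
  by (simp add: F_subset card_mono finite_V)

section \<open>Characters of the code\<close>

lemma minus_one_power_card_sym_diff: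
  assumes "finite A" "finite A'"
  shows "(- 1 :: 'c :: comm_ring_1) ^ card (sym_diff A A' \<inter> B) = (- 1) ^ card (A \<inter> B) * (- 1) ^ card (A' \<inter> B)"
proof -
  have "sym_diff A A' \<inter> B = sym_diff (A \<inter> B) (A' \<inter> B)" by blast
  then have "card (sym_diff A A' \<inter> B) = card (A \<inter> B - A' \<inter> B) + card (A' \<inter> B - A \<inter> B)"
    using assms by (simp add: card_Un_disjoint Diff_Int_distrib2 inf_commute disjoint_iff)
  moreover have "card (A \<inter> B) = card (A \<inter> B \<inter> (A' \<inter> B)) + card (A \<inter> B - A' \<inter> B)"
    "card (A' \<inter> B) = card (A \<inter> B \<inter> (A' \<inter> B)) + card (A' \<inter> B - A \<inter> B)"
    using assms card_Int_Diff[of "A \<inter> B" "A' \<inter> B"] card_Int_Diff[of "A' \<inter> B" "A \<inter> B"]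
    by (simp_all add: Int_commute)
  ultimately show ?thesis by (simp add: power_add minus_one_power_iff)
qed

text \<open>Orthogonality of characters: if \<open>B\<close> is not in the dual, translation by some
  \<open>A0\<close> that meets \<open>B\<close> oddly permutes \<open>F\<close> and flips every
  sign, so the sum equals its own negative.\<close>

lemma character_sum:
  assumes "B \<subseteq> V"
  shows "(\<Sum>A\<in>F. (- 1 :: 'c :: {idom, semiring_char_0}) ^ card (A \<inter> B)) = (if B \<in> D then of_nat (card F) else 0)"
proof (cases "B \<in> D")
  case True
  then have "(\<Sum>A\<in>F. (- 1 :: 'c) ^ card (A \<inter> B)) = (\<Sum>A\<in>F. 1)"
    by (intro sum.cong) (auto simp: dual_family_def)
  with True show ?thesis by simp
next
  case False
  with assms obtain A0 where A0: "A0 \<in> F" "odd (card (A0 \<inter> B))"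
    by (auto simp: dual_family_def)
  have inv: "sym_diff (sym_diff A A0) A0 = A" for A :: "'a set" by blast
  have "(\<Sum>A\<in>F. (- 1 :: 'c) ^ card (A \<inter> B)) = (\<Sum>A\<in>F. (- 1) ^ card (sym_diff A A0 \<inter> B))"
    by (rule sum.reindex_bij_witness[of _ "\<lambda>A. sym_diff A A0" "\<lambda>A. sym_diff A A0"])
      (use sym_diff_in A0 inv in auto)
  also have "\<dots> = (\<Sum>A\<in>F. - ((- 1) ^ card (A \<inter> B)))"
    using A0 by (intro sum.cong) (auto simp: minus_one_power_card_sym_diff finite_member)
  finally show ?thesis using False by (simp add: sum_negf eq_neg_iff_add_eq_0 flip: mult_2)
qed

section \<open>Complementation and the support of \<open>block_diff\<close>\<close>

lemma blocks_through_eq_0: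
  assumes "u < card T"
  shows "blocks_through F u T = 0"
proof -
  have "card T \<le> card A" if "A \<in> F" "T \<subseteq> A" for A
    using that by (simp add: card_mono finite_member)
  with assms have "{A \<in> F. card A = u \<and> T \<subseteq> A} = {}" by force
  then show ?thesis by (simp add: blocks_through_def)
qed

text \<open>Complementation is addition of the all-ones word, so it preserves \<open>F\<close> and
  turns codewords containing \<open>T\<close> into codewords avoiding \<open>T\<close>;
  inclusion-exclusion over the subsets of \<open>T\<close> counts the latter.\<close>

lemma blocks_through_complement:
  assumes "T \<subseteq> V" "u \<le> n"
  shows "real (blocks_through F (n - u) T) = (\<Sum>I\<in>Pow T. (- 1) ^ card I * real (blocks_through F u I))"
proof -
  have fT: "finite T" using assms finite_V finite_subset by blast
  have "blocks_through F (n - u) T = card {A \<in> F. card A = u \<and> A \<inter> T = {}}"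
    unfolding blocks_through_def
  proof (rule bij_betw_same_card[of "\<lambda>A. V - A"], rule bij_betw_byWitness[where f' = "\<lambda>A. V - A"])
    have compl: "V - A \<in> F" if "A \<in> F" for A
    proof -
      have "V - A = sym_diff V A" using F_subset[OF that] by blast
      then show ?thesis using sym_diff_in[OF full_in that] by simp
    qed
    have cc: "card (V - A) = n - card A" if "A \<in> F" for A
      using that F_subset finite_V finite_member by (simp add: card_Diff_subset)
    show "(\<lambda>A. V - A) ` {A \<in> F. card A = n - u \<and> T \<subseteq> A} \<subseteq> {A \<in> F. card A = u \<and> A \<inter> T = {}}"
      using compl cc assms by auto
    show "(\<lambda>A. V - A) ` {A \<in> F. card A = u \<and> A \<inter> T = {}} \<subseteq> {A \<in> F. card A = n - u \<and> T \<subseteq> A}"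
      using compl cc assms by auto
  qed (use F_subset in auto)
  also have "real \<dots> = (\<Sum>A | A \<in> F \<and> card A = u. if A \<inter> T = {} then 1 else 0)"
    by (simp add: sum.If_cases conj_ac Collect_conj_eq Int_ac)
  \<comment> \<open>The alternating sum over \<open>Pow (A \<inter> T)\<close> equals
    \<open>0 ^ card (A \<inter> T)\<close>, the indicator of disjointness.\<close>
  also have "\<dots> = (\<Sum>A | A \<in> F \<and> card A = u. \<Sum>I\<in>Pow (A \<inter> T). (- 1) ^ card I)"
  proof (rule sum.cong)
    fix A
    have "(\<Sum>I\<in>Pow (A \<inter> T). (- 1 :: real) ^ card I) = (- 1 + 1) ^ card (A \<inter> T)"
      using sum_Pow_power[of T "A \<inter> T" "- 1 :: real" 1] fT by simp
    then show "(if A \<inter> T = {} then 1 else 0) = (\<Sum>I\<in>Pow (A \<inter> T). (- 1 :: real) ^ card I)"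
      using fT by (simp add: power_0_left)
  qed simp
  also have "\<dots> = (\<Sum>A | A \<in> F \<and> card A = u. \<Sum>I | I \<in> Pow T \<and> I \<subseteq> A. (- 1) ^ card I)"
    by (intro sum.cong) auto
  also have "\<dots> = (\<Sum>I\<in>Pow T. \<Sum>A | A \<in> {A \<in> F. card A = u} \<and> I \<subseteq> A. (- 1) ^ card I)"
    using fT by (subst sum.swap_restrict) auto
  also have "\<dots> = (\<Sum>I\<in>Pow T. (- 1) ^ card I * real (blocks_through F u I))"
    by (intro sum.cong) (auto simp: blocks_through_def conj_ac)
  finally show ?thesis .
qed

lemma block_diff_complement:
  assumes "T \<subseteq> V" "T' \<subseteq> V" "card T' = card T" "u \<le> n"
    and smaller: "designs_below (card T)"
  shows "block_diff F T T' (n - u) = (- 1) ^ card T * block_diff F T T' u"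
  unfolding block_diff_def blocks_through_complement[OF assms(1,4)] blocks_through_complement[OF assms(2,4)]
proof (rule sum_Pow_diff)
  show "finite T" "finite T'" using assms finite_V finite_subset by blast+
  show "real (blocks_through F u I) = real (blocks_through F u I')"
    if "I \<subseteq> T" "I' \<subseteq> T'" "card I' = card I" "card I < card T" for I I'
    using designs_belowD[OF smaller, of I I'] that assms(1,2) by auto
qed (use assms in simp)

text \<open>No set of size below \<open>card T\<close> contains \<open>T\<close> or
  \<open>T'\<close>, which gives the lower bound on \<open>u\<close>; the upper bound is its mirror
  image under \<open>block_diff_complement\<close>.\<close>

lemma block_diff_support:
  assumes "T \<subseteq> V" "T' \<subseteq> V" "card T' = card T"
    and smaller: "designs_below (card T)"
    and "block_diff F T T' u \<noteq> 0"
  shows "u \<in> card ` F" "card T \<le> u" "u + card T \<le> n"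
proof -
  show weight: "u \<in> card ` F"
  proof (rule ccontr)
    assume "u \<notin> card ` F"
    then have none: "{A \<in> F. card A = u \<and> I \<subseteq> A} = {}" for I by blast
    show False using assms(5) unfolding block_diff_def blocks_through_def none by simp
  qed
  have small: "block_diff F T T' v = 0" if "v < card T" for v
    using that assms(3) by (simp add: block_diff_def blocks_through_eq_0)
  show "card T \<le> u" using small assms(5) not_le by blast
  have "u \<le> n" using weight card_le by blast
  then have "block_diff F T T' (n - u) \<noteq> 0"
    using block_diff_complement[OF assms(1-3) \<open>u \<le> n\<close> smaller] assms(5) by simp
  then have "card T \<le> n - u" using small not_le by blast
  then show "u + card T \<le> n" using \<open>u \<le> n\<close> by linarith
qed

section \<open>Binomial moments and the Assmus-Mattson theorem\<close>

text \<open>Fewer than \<open>dp\<close> coordinates are independent on the code, so all patterns on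
  \<open>J\<close> are equally frequent. In the character expansion of the indicator of
  \<open>J \<subseteq> A\<close>, a nonempty \<open>K \<subseteq> J\<close> is too small to be a
  dual word, and only \<open>K = {}\<close> contributes.\<close>

lemma card_supersets:
  assumes dual_dist: "\<forall>B\<in>D. B \<noteq> {} \<longrightarrow> dp \<le> card B"
    and "J \<subseteq> V" "card J < dp"
  shows "2 ^ card J * real (card {A \<in> F. J \<subseteq> A}) = real (card F)"
proof -
  have fJ: "finite J" using assms finite_V finite_subset by blast
  have "2 ^ card J * real (card {A \<in> F. J \<subseteq> A}) = (\<Sum>A\<in>F. if J \<subseteq> A then 2 ^ card J else 0)"
    by (simp add: sum.If_cases Collect_conj_eq)
  \<comment> \<open>This is \<open>sum_Pow_signed_power\<close> at \<open>x = -1\<close>, where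
    \<open>1 - x = 2\<close> and \<open>1 + x = 0\<close>.\<close>
  also have "\<dots> = (\<Sum>A\<in>F. \<Sum>K\<in>Pow J. (- 1) ^ card (A \<inter> K) * (- 1) ^ card K)"
  proof (rule sum.cong)
    fix A
    show "(if J \<subseteq> A then 2 ^ card J else 0) = (\<Sum>K\<in>Pow J. (- 1 :: real) ^ card (A \<inter> K) * (- 1) ^ card K)"
      unfolding sum_Pow_signed_power[OF fJ] using fJ by (auto simp: Int_absorb1 power_0_left)
  qed simp
  also have "\<dots> = (\<Sum>K\<in>Pow J. (\<Sum>A\<in>F. (- 1) ^ card (A \<inter> K)) * (- 1) ^ card K)"
    by (subst sum.swap) (simp add: sum_distrib_right)
  also have "\<dots> = (\<Sum>K\<in>Pow J. if K = {} then real (card F) else 0)"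
  proof (rule sum.cong)
    fix K assume K: "K \<in> Pow J"
    have "K \<notin> D" if "K \<noteq> {}"
      using dual_dist that K assms(3) fJ card_mono[of J K] by auto
    moreover have "{} \<in> D" by (simp add: dual_family_def)
    ultimately show "(\<Sum>A\<in>F. (- 1) ^ card (A \<inter> K)) * (- 1) ^ card K = (if K = {} then real (card F) else 0)"
      using K assms(2) by (subst character_sum) auto
  qed simp
  also have "\<dots> = real (card F)" using fJ by simp
  finally show ?thesis .
qed

text \<open>Double counting of pairs of a codeword \<open>A\<close> through \<open>T\<close> and an
  \<open>m\<close>-subset \<open>J\<close> of \<open>A - T\<close>: since
  \<open>T \<union> J\<close> has fewer than \<open>dp\<close> elements,
  \<open>card_supersets\<close> counts the codewords for each \<open>J\<close>.\<close>

lemma binomial_moment: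
  assumes dual_dist: "\<forall>B\<in>D. B \<noteq> {} \<longrightarrow> dp \<le> card B"
    and "T \<subseteq> V" "card T + m < dp"
  shows "(\<Sum>A | A \<in> F \<and> T \<subseteq> A. real ((card A - card T) choose m))
    = real ((n - card T) choose m) * (real (card F) / 2 ^ (card T + m))"
proof -
  let ?J = "{J. J \<subseteq> V - T \<and> card J = m}"
  have fT: "finite T" using assms finite_V finite_subset by blast
  have fJ: "finite ?J" using finite_V by simp
  have "(\<Sum>A | A \<in> F \<and> T \<subseteq> A. real ((card A - card T) choose m))
      = (\<Sum>A | A \<in> F \<and> T \<subseteq> A. \<Sum>J | J \<in> ?J \<and> J \<subseteq> A. 1)"
  proof (rule sum.cong)
    fix A assume A: "A \<in> {A. A \<in> F \<and> T \<subseteq> A}"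
    then have "{J. J \<in> ?J \<and> J \<subseteq> A} = {J. J \<subseteq> A - T \<and> card J = m}"
      using F_subset by blast
    then have "card {J. J \<in> ?J \<and> J \<subseteq> A} = card (A - T) choose m"
      using A finite_member n_subsets[of "A - T" m] by simp
    then show "real ((card A - card T) choose m) = (\<Sum>J | J \<in> ?J \<and> J \<subseteq> A. 1)"
      using A fT by (simp add: card_Diff_subset)
  qed simp
  also have "\<dots> = (\<Sum>J\<in>?J. \<Sum>A | A \<in> {A. A \<in> F \<and> T \<subseteq> A} \<and> J \<subseteq> A. 1)"
    by (rule sum.swap_restrict) (use fJ in auto)
  also have "\<dots> = (\<Sum>J\<in>?J. real (card F) / 2 ^ (card T + m))"
  proof (rule sum.cong)
    fix J assume J: "J \<in> ?J"
    then have c: "card (T \<union> J) = card T + m"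
      using fT finite_V finite_subset by (subst card_Un_disjoint) auto
    have "{A. A \<in> {A. A \<in> F \<and> T \<subseteq> A} \<and> J \<subseteq> A} = {A \<in> F. T \<union> J \<subseteq> A}" by blast
    then show "(\<Sum>A | A \<in> {A. A \<in> F \<and> T \<subseteq> A} \<and> J \<subseteq> A. 1) = real (card F) / 2 ^ (card T + m)"
      using card_supersets[OF dual_dist, of "T \<union> J"] J assms(2,3) c by (auto simp: field_simps)
  qed simp
  also have "card ?J = (n - card T) choose m"
    using n_subsets[of "V - T" m] finite_V assms(2) fT by (simp add: card_Diff_subset)
  then have "(\<Sum>J\<in>?J. real (card F) / 2 ^ (card T + m)) = real ((n - card T) choose m) * (real (card F) / 2 ^ (card T + m))"
    by simp
  finally show ?thesis .
qed

text \<open>The value in \<open>binomial_moment\<close> depends on \<open>T\<close> only through its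
  size, so it cancels in the difference.\<close>

lemma block_diff_moment:
  assumes dual_dist: "\<forall>B\<in>D. B \<noteq> {} \<longrightarrow> dp \<le> card B"
    and "T \<subseteq> V" "T' \<subseteq> V" "card T' = card T" "card T + m < dp"
  shows "(\<Sum>u\<le>n. block_diff F T T' u * real ((u - card T) choose m)) = 0"
proof -
  let ?g = "\<lambda>u. real ((u - card T) choose m)"
  have "(\<Sum>u\<le>n. block_diff F T T' u * ?g u)
      = (\<Sum>u\<le>n. real (blocks_through F u T) * ?g u) - (\<Sum>u\<le>n. real (blocks_through F u T') * ?g u)"
    by (simp add: block_diff_def algebra_simps sum_subtractf)
  also have "\<dots> = 0"
    using binomial_moment[OF dual_dist, of T m] binomial_moment[OF dual_dist, of T' m] assms(2-5)
    by (simp add: card_le flip: sum_card_eq_blocks_through[where F = F and n = n and g = ?g])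
  finally show ?thesis .
qed

text \<open>Strong induction on \<open>s\<close>: the smaller sizes confine the difference to
  weights in \<open>{s..n - s}\<close>. At most \<open>dp - t\<close> of these are counted by the
  hypothesis and at most \<open>t - s\<close> lie above \<open>n - t\<close>, so there are no more
  unknowns than the \<open>dp - s\<close> vanishing moments.\<close>

lemma assmus_mattson:
  assumes dual_dist: "\<forall>B\<in>D. B \<noteq> {} \<longrightarrow> dp \<le> card B"
    and dp: "dp = t + card {u \<in> card ` F. 0 < u \<and> u + t \<le> n}"
    and "s \<le> t" "T \<subseteq> V" "T' \<subseteq> V" "card T = s" "card T' = s"
  shows "blocks_through F u T = blocks_through F u T'"
  using assms(3-7)
proof (induction s arbitrary: T T' u rule: less_induct)
  case (less s)
  have fin: "finite T" "finite T'" using less.prems finite_V finite_subset by blast+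
  show ?case
  proof (cases "s = 0")
    case True
    then have "T = {}" "T' = {}" using less.prems fin by auto
    then show ?thesis by simp
  next
    case False
    have smaller: "designs_below (card T)"
      unfolding designs_below_def
    proof (intro allI impI)
      fix I I' u
      assume I: "I \<subseteq> V" "I' \<subseteq> V" "card I' = card I" "card I < card T"
      show "blocks_through F u I = blocks_through F u I'"
        by (rule less.IH[of "card I"]) (use I less.prems in simp_all)
    qed
    have card_eq: "card T' = card T" using less.prems by simp
    let ?S = "{u \<in> card ` F. s \<le> u \<and> u + s \<le> n}"
    \<comment> \<open>The second set collects the weights \<open>u\<close> with
      \<open>u + t > n\<close> and \<open>u + s \<le> n\<close>. The bound \<open>t - s\<close> on
      its size uses \<open>s \<le> n\<close>, which comes from \<open>T \<subseteq> V\<close>, and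
      it also covers \<open>t > n\<close>, where the left endpoint truncates to 0.\<close>
    have "?S \<subseteq> {u \<in> card ` F. 0 < u \<and> u + t \<le> n} \<union> {Suc n - t..n - s}"
      using False by auto
    then have "card ?S \<le> card ({u \<in> card ` F. 0 < u \<and> u + t \<le> n} \<union> {Suc n - t..n - s})"
      by (rule card_mono[rotated]) simp
    also have "\<dots> \<le> card {u \<in> card ` F. 0 < u \<and> u + t \<le> n} + card {Suc n - t..n - s}"
      by (rule card_Un_le)
    also have "card {Suc n - t..n - s} \<le> t - s"
      using less.prems card_mono[OF finite_V, of T] by auto
    finally have card_S: "card ?S \<le> dp - s" using dp less.prems by simp
    have support: "u \<in> ?S" if "block_diff F T T' u \<noteq> 0" for u
      using block_diff_support[OF less.prems(2,3) card_eq smaller that] less.prems by simp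
    have "block_diff F T T' u = 0"
    proof (rule ccontr)
      assume nz: "block_diff F T T' u \<noteq> 0"
      have "block_diff F T T' u = 0"
      proof (rule vanishing_if_binomial_moments_vanish[OF _ card_S])
        fix m assume "m < dp - s"
        then have "(\<Sum>u\<le>n. block_diff F T T' u * real ((u - s) choose m)) = 0"
          using block_diff_moment[OF dual_dist, of T T' m] less.prems by simp
        moreover have "(\<Sum>u\<in>?S. block_diff F T T' u * real ((u - s) choose m))
            = (\<Sum>u\<le>n. block_diff F T T' u * real ((u - s) choose m))"
          using support by (intro sum.mono_neutral_left) auto
        ultimately show "(\<Sum>u\<in>?S. block_diff F T T' u * real ((u - s) choose m)) = 0" by simp
      qed (use support[OF nz] in auto)
      with nz show False by simp
    qed
    then show ?thesis by (simp add: block_diff_def)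
  qed
qed

section \<open>MacWilliams duality for codewords through a fixed set\<close>

text \<open>
  MacWilliams duality for the dual codewords through \<open>T\<close>. On the right the signs
  \<open>(-1) ^ card (A \<inter> T)\<close> have been expanded over the subsets \<open>I\<close> of \<open>T\<close>; the factor
  \<open>((1 - x) * (1 + x)) ^ card T\<close> clears the denominators this creates.
\<close>
lemma dual_enumerator:
  fixes x :: "'c :: {idom, semiring_char_0}"
  assumes "T \<subseteq> V"
  shows "of_nat (card F) * ((1 - x) * (1 + x)) ^ card T * (\<Sum>B | B \<in> D \<and> T \<subseteq> B. x ^ (card B - card T))
    = (\<Sum>I\<in>Pow T. (- 2) ^ card I * (1 - x) ^ (card T - card I) *
        (\<Sum>u\<le>n. of_nat (blocks_through F u I) * ((1 - x) ^ u * (1 + x) ^ (n - u))))"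
proof -
  let ?P = "\<lambda>A. ((1 - x) * (1 + x)) ^ card T *
    (\<Sum>B | B \<in> Pow V \<and> T \<subseteq> B. (- 1) ^ card (A \<inter> B) * x ^ (card B - card T))"
  have fT: "finite T" using assms finite_V finite_subset by blast
  have "of_nat (card F) * (\<Sum>B | B \<in> D \<and> T \<subseteq> B. x ^ (card B - card T))
      = (\<Sum>B | B \<in> Pow V \<and> T \<subseteq> B. if B \<in> D then of_nat (card F) * x ^ (card B - card T) else 0)"
    unfolding sum_distrib_left using finite_V
    by (intro sum.mono_neutral_cong_left) (auto simp: dual_family_def)
  also have "\<dots> = (\<Sum>B | B \<in> Pow V \<and> T \<subseteq> B. (\<Sum>A\<in>F. (- 1) ^ card (A \<inter> B)) * x ^ (card B - card T))"
    by (intro sum.cong) (auto simp: character_sum)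
  also have "\<dots> = (\<Sum>A\<in>F. \<Sum>B | B \<in> Pow V \<and> T \<subseteq> B. (- 1) ^ card (A \<inter> B) * x ^ (card B - card T))"
    unfolding sum_distrib_right by (rule sum.swap)
  finally have *: "of_nat (card F) * (\<Sum>B | B \<in> D \<and> T \<subseteq> B. x ^ (card B - card T))
      = (\<Sum>A\<in>F. \<Sum>B | B \<in> Pow V \<and> T \<subseteq> B. (- 1) ^ card (A \<inter> B) * x ^ (card B - card T))" .
  have "of_nat (card F) * ((1 - x) * (1 + x)) ^ card T * (\<Sum>B | B \<in> D \<and> T \<subseteq> B. x ^ (card B - card T))
      = ((1 - x) * (1 + x)) ^ card T *
        (\<Sum>A\<in>F. \<Sum>B | B \<in> Pow V \<and> T \<subseteq> B. (- 1) ^ card (A \<inter> B) * x ^ (card B - card T))"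
    unfolding *[symmetric] by (simp only: mult_ac)
  also have "\<dots> = (\<Sum>A\<in>F. ?P A)"
    by (rule sum_distrib_left)
  also have "\<dots> = (\<Sum>A\<in>F. \<Sum>I | I \<in> Pow T \<and> I \<subseteq> A.
      (- 2) ^ card I * (1 - x) ^ (card T - card I) * ((1 - x) ^ card A * (1 + x) ^ (n - card A)))"
  proof (rule sum.cong)
    fix A assume A: "A \<in> F"
    have fA: "finite A" using A finite_member by blast
    \<comment> \<open>Every \<open>B\<close> considered contains \<open>T\<close>, so the sign
      caused by \<open>T\<close> is constant and \<open>B - T\<close> ranges freely over the subsets
      of \<open>V - T\<close>.\<close>
    have split: "(- 1 :: 'c) ^ card (A \<inter> B) * x ^ (card B - card T)
        = (- 1) ^ card (A \<inter> T) * ((- 1) ^ card (A \<inter> (B - T)) * x ^ card (B - T))"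
      if "T \<subseteq> B" for B
    proof -
      have "A \<inter> B = (A \<inter> T) \<union> (A \<inter> (B - T))" using that by blast
      then have "card (A \<inter> B) = card (A \<inter> T) + card (A \<inter> (B - T))"
        using fA by (metis Diff_disjoint Int_assoc Int_left_commute card_Un_disjoint finite_Int inf_bot_right)
      then show ?thesis using that fT by (simp add: power_add card_Diff_subset)
    qed
    have "(\<Sum>B | B \<in> Pow V \<and> T \<subseteq> B. (- 1) ^ card (A \<inter> B) * x ^ (card B - card T))
        = (\<Sum>E\<in>Pow (V - T). (- 1) ^ card (A \<inter> T) * ((- 1) ^ card (A \<inter> E) * x ^ card E))"
      by (rule sum.reindex_bij_witness[of _ "\<lambda>E. T \<union> E" "\<lambda>B. B - T"])
        (use assms in \<open>auto simp: Un_absorb1 split\<close>)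
    also have "\<dots> = (- 1) ^ card (A \<inter> T) * ((1 - x) ^ card (A \<inter> (V - T)) * (1 + x) ^ card (V - T - A))"
      using finite_V by (simp add: sum_Pow_signed_power flip: sum_distrib_left)
    finally have P: "?P A = ((1 - x) * (1 + x)) ^ card T *
        ((- 1) ^ card (A \<inter> T) * ((1 - x) ^ card (A \<inter> (V - T)) * (1 + x) ^ card (V - T - A)))"
      by simp
    let ?j = "card (A \<inter> T)"
    have j: "?j \<le> card T" using fT by (simp add: card_mono)
    have cA: "card A = card (A \<inter> (V - T)) + ?j"
    proof -
      have "A = A \<inter> (V - T) \<union> A \<inter> T" using F_subset[OF A] by blast
      then show ?thesis using fA by (metis (no_types, lifting) Diff_disjoint card_Un_disjoint finite_Int inf_assoc inf_bot_right inf_commute)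
    qed
    have cc: "n - card A + ?j = card T + card (V - T - A)"
    proof -
      have "(V - A) \<union> (A \<inter> T) = T \<union> (V - T - A)" using assms by blast
      moreover have "card ((V - A) \<union> (A \<inter> T)) = card (V - A) + ?j"
        using finite_V fA by (intro card_Un_disjoint) auto
      moreover have "card (T \<union> (V - T - A)) = card T + card (V - T - A)"
        using finite_V fT by (intro card_Un_disjoint) auto
      ultimately show ?thesis using F_subset[OF A] fA by (simp add: card_Diff_subset)
    qed
    have "?P A = (- 1) ^ ?j * ((1 - x) ^ (card T + card (A \<inter> (V - T))) * (1 + x) ^ (n - card A + ?j))"
      unfolding P cc by (simp add: power_add power_mult_distrib mult_ac)
    also have "card T + card (A \<inter> (V - T)) = card T - ?j + card A"
      using cA j by simp
    \<comment> \<open>After \<open>(1 - x) ^ card A * (1 + x) ^ (n - card A)\<close> is split off,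
      \<open>(- (1 + x)) ^ ?j * (1 - x) ^ (card T - ?j)\<close> remains. Writing
      \<open>- (1 + x)\<close> as \<open>- 2 + (1 - x)\<close> fits it to
      \<open>sum_Pow_power\<close>, after which \<open>A\<close> enters only through its weight and
      the condition \<open>I \<subseteq> A\<close>.\<close>
    also have "(- 1) ^ ?j * ((1 - x) ^ (card T - ?j + card A) * (1 + x) ^ (n - card A + ?j))
        = (- 2 + (1 - x)) ^ ?j * (1 - x) ^ (card T - ?j) * ((1 - x) ^ card A * (1 + x) ^ (n - card A))"
    proof -
      have "- 2 + (1 - x) = (- 1) * (1 + x)" by simp
      then show ?thesis by (simp add: power_add power_mult_distrib[of "- 1"] mult_ac del: mult_minus1 mult_minus_left)
    qed
    also have "\<dots> = (\<Sum>I\<in>Pow (A \<inter> T). (- 2) ^ card I * (1 - x) ^ (card T - card I)) * ((1 - x) ^ card A * (1 + x) ^ (n - card A))"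
      using sum_Pow_power[OF fT, of "A \<inter> T" "- 2" "1 - x"] by simp
    also have "Pow (A \<inter> T) = {I. I \<in> Pow T \<and> I \<subseteq> A}" by blast
    finally show "?P A = (\<Sum>I | I \<in> Pow T \<and> I \<subseteq> A.
        (- 2) ^ card I * (1 - x) ^ (card T - card I) * ((1 - x) ^ card A * (1 + x) ^ (n - card A)))"
      by (simp add: sum_distrib_right)
  qed simp
  also have "\<dots> = (\<Sum>I\<in>Pow T. \<Sum>A | A \<in> F \<and> I \<subseteq> A.
      (- 2) ^ card I * (1 - x) ^ (card T - card I) * ((1 - x) ^ card A * (1 + x) ^ (n - card A)))"
    using fT by (intro sum.swap_restrict) auto
  also have "\<dots> = (\<Sum>I\<in>Pow T. (- 2) ^ card I * (1 - x) ^ (card T - card I) *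
        (\<Sum>u\<le>n. of_nat (blocks_through F u I) * ((1 - x) ^ u * (1 + x) ^ (n - u))))"
    by (simp add: card_le flip: sum_distrib_left sum_card_eq_blocks_through[where F = F and n = n and g = "\<lambda>u. (1 - x) ^ u * (1 + x) ^ (n - u)"])
  finally show ?thesis .
qed

text \<open>Subtracting the two expansions leaves only the top term by \<open>sum_Pow_diff\<close>.
  Its weights lie between \<open>card T\<close> and \<open>n - card T\<close>, so the clearing
  factor \<open>((1 - x) * (1 + x)) ^ card T\<close> divides every summand and can be cancelled in
  the domain of power series.\<close>

lemma dual_enumerator_diff:
  fixes x :: "real fps"
  assumes "T \<subseteq> V" "T' \<subseteq> V" "card T' = card T" "(1 - x) * (1 + x) \<noteq> 0"
    and smaller: "designs_below (card T)"
  shows "of_nat (card F) * ((\<Sum>B | B \<in> D \<and> T \<subseteq> B. x ^ (card B - card T)) - (\<Sum>B | B \<in> D \<and> T' \<subseteq> B. x ^ (card B - card T)))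
    = (- 2) ^ card T * (\<Sum>u\<in>{card T..n - card T}. fps_const (block_diff F T T' u) * ((1 - x) ^ (u - card T) * (1 + x) ^ (n - u - card T)))"
    (is "_ * (?W - ?W') = _ * ?R")
proof -
  let ?s = "card T"
  let ?g = "\<lambda>u. (1 - x) ^ u * (1 + x) ^ (n - u)"
  let ?G = "\<lambda>I. \<Sum>u\<le>n. of_nat (blocks_through F u I) * ?g u"
  have "((1 - x) * (1 + x)) ^ ?s * (of_nat (card F) * (?W - ?W'))
      = (\<Sum>I\<in>Pow T. (- 2) ^ card I * (1 - x) ^ (?s - card I) * ?G I)
        - (\<Sum>I\<in>Pow T'. (- 2) ^ card I * (1 - x) ^ (?s - card I) * ?G I)"
    using dual_enumerator[OF assms(1), of x] dual_enumerator[OF assms(2), of x] assms(3)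
    by (simp add: algebra_simps)
  also have "\<dots> = (- 2) ^ ?s * (1 - x) ^ (?s - ?s) * (?G T - ?G T')"
  proof (rule sum_Pow_diff)
    show "finite T" "finite T'" using assms finite_V finite_subset by blast+
    show "?G I = ?G I'" if "I \<subseteq> T" "I' \<subseteq> T'" "card I' = card I" "card I < card T" for I I'
      using designs_belowD[OF smaller, of I I'] that assms(1,2) by auto
  qed (use assms in simp)
  also have "?G T - ?G T' = (\<Sum>u\<le>n. fps_const (block_diff F T T' u) * ?g u)"
    by (simp add: block_diff_def algebra_simps sum_subtractf fps_of_nat flip: fps_const_sub)
  also have "\<dots> = (\<Sum>u\<in>{?s..n - ?s}. fps_const (block_diff F T T' u) * ?g u)"
  proof (rule sum.mono_neutral_right)
    show "\<forall>u\<in>{..n} - {?s..n - ?s}. fps_const (block_diff F T T' u) * ?g u = 0"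
      using block_diff_support[OF assms(1-3) smaller] by fastforce
  qed auto
  also have "\<dots> = ((1 - x) * (1 + x)) ^ ?s * ?R"
    unfolding sum_distrib_left
  proof (rule sum.cong)
    fix u assume "u \<in> {?s..n - ?s}"
    moreover have "?s \<le> n" using assms(1) finite_V by (simp add: card_mono)
    ultimately obtain a b where "u = ?s + a" "n - u = ?s + b" "u - ?s = a" "n - u - ?s = b"
      by (metis (no_types, lifting) Nat.le_diff_conv2 add.commute add_diff_inverse_nat atLeastAtMost_iff le_trans linorder_not_less diff_le_mono2 diff_diff_cancel)
    then show "fps_const (block_diff F T T' u) * ?g u
        = ((1 - x) * (1 + x)) ^ ?s * (fps_const (block_diff F T T' u) * ((1 - x) ^ (u - ?s) * (1 + x) ^ (n - u - ?s)))"
      by (simp add: power_add power_mult_distrib mult_ac)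
  qed simp
  finally have "((1 - x) * (1 + x)) ^ ?s * (of_nat (card F) * (?W - ?W')) = ((1 - x) * (1 + x)) ^ ?s * ((- 2) ^ ?s * ?R)"
    by (simp add: mult_ac)
  then show ?thesis using assms(4) by simp
qed

end

section \<open>Coefficients of the difference of dual weight enumerators\<close>

lemma power_linear_nth:
  fixes c :: real
  shows "((1 + fps_const c * fps_X) ^ N) $ k = c ^ k * (real N gchoose k)"
proof -
  have "((1 + fps_const c * fps_X) ^ N) $ k
      = ((\<Sum>j\<le>N. of_nat (N choose j) * (fps_const c * fps_X) ^ j) :: real fps) $ k"
    using binomial_ring[of "fps_const c * fps_X" 1 N] by (simp add: add.commute)
  also have "\<dots> = (\<Sum>j\<le>N. real (N choose j) * (c ^ j * (if k = j then 1 else 0)))"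
    by (simp add: fps_sum_nth power_mult_distrib fps_const_power flip: fps_of_nat fps_const_mult)
  also have "\<dots> = (\<Sum>j\<le>N. if j = k then c ^ k * real (N choose k) else 0)"
    by (intro sum.cong) auto
  also have "\<dots> = c ^ k * (real N gchoose k)"
    by (simp add: binomial_gbinomial[symmetric] binomial_eq_0)
  finally show ?thesis .
qed

text \<open>Since \<open>(1 - fps_X) * (1 + fps_X) = 1 - fps_X ^ 2\<close>, only coefficients of
  \<open>G\<close> at indices of the parity \<open>e\<close> are involved; this produces the
  alternating sums of the theorem.\<close>

lemma one_minus_square_power_mult_nth:
  fixes G :: "real fps"
  assumes "e \<le> 1"
  shows "(((1 - fps_X) * (1 + fps_X)) ^ m * G) $ (2 * w + e)
    = (\<Sum>i = 0..w. (- 1) ^ (w - i) * (real m gchoose (w - i)) * G $ (2 * i + e))"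
proof -
  let ?f = "\<lambda>j. (- 1) ^ j * (real (m choose j) * (if 2 * w + e < 2 * j then 0 else G $ (2 * w + e - 2 * j)))"
  have "(1 - fps_X) * (1 + fps_X) = - (fps_X ^ 2) + (1 :: real fps)"
    by (simp add: algebra_simps power2_eq_square)
  then have "((1 - fps_X) * (1 + fps_X)) ^ m = (\<Sum>j\<le>m. of_nat (m choose j) * (- (fps_X ^ 2)) ^ j :: real fps)"
    using binomial_ring[of "- (fps_X ^ 2) :: real fps" 1 m] by simp
  also have "\<dots> = (\<Sum>j\<le>m. fps_const ((- 1) ^ j * real (m choose j)) * fps_X ^ (2 * j))"
  proof (rule sum.cong)
    fix j
    have "(- (fps_X ^ 2)) ^ j = fps_const ((- 1) ^ j) * (fps_X ^ (2 * j) :: real fps)"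
      by (subst power_minus) (simp add: power_mult flip: fps_const_power fps_const_neg)
    then show "of_nat (m choose j) * (- (fps_X ^ 2)) ^ j
        = fps_const ((- 1) ^ j * real (m choose j)) * (fps_X ^ (2 * j) :: real fps)"
      by (simp add: mult_ac flip: fps_of_nat fps_const_mult)
  qed simp
  finally have "(((1 - fps_X) * (1 + fps_X)) ^ m * G) $ (2 * w + e) = (\<Sum>j\<le>m. ?f j)"
    by (simp add: sum_distrib_right fps_sum_nth mult.assoc fps_X_power_mult_nth)
  \<comment> \<open>Terms with \<open>j > w\<close> vanish because \<open>e \<le> 1\<close> makes
    \<open>2 * w + e < 2 * j\<close>; terms with \<open>j > m\<close> have a zero binomial.\<close>
  also have "\<dots> = (\<Sum>j\<le>w. ?f j)"
    using assms by (intro sum.mono_neutral_cong) (auto simp: binomial_eq_0)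
  also have "\<dots> = (\<Sum>i = 0..w. ?f (w - i))"
    by (rule sum.reindex_bij_witness[of _ "\<lambda>i. w - i" "\<lambda>i. w - i"]) auto
  also have "\<dots> = (\<Sum>i = 0..w. (- 1) ^ (w - i) * (real m gchoose (w - i)) * G $ (2 * i + e))"
    by (intro sum.cong) (auto simp: binomial_gbinomial diff_mult_distrib2 add.commute)
  finally show ?thesis .
qed

context binary_code
begin

text \<open>The right-hand side of \<open>dual_enumerator_diff\<close> at \<open>fps_X\<close>,
  without the constant \<open>(- 2) ^ card T\<close>.\<close>

abbreviation enumerator_defect :: "'a set \<Rightarrow> 'a set \<Rightarrow> real fps" where
  "enumerator_defect T T' \<equiv> (\<Sum>u\<in>{card T..n - card T}. fps_const (block_diff F T T' u) *
    ((1 - fps_X) ^ (u - card T) * (1 + fps_X) ^ (n - u - card T)))"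

text \<open>Compare coefficients at \<open>m\<close> in \<open>dual_enumerator_diff\<close>: on the
  left they are the numbers of dual words of weight \<open>m + card T\<close>, multiplied by the
  nonzero constant \<open>card F\<close>.\<close>

lemma dual_blocks_through_eq:
  assumes "T \<subseteq> V" "T' \<subseteq> V" "card T' = card T"
    and smaller: "designs_below (card T)"
    and "enumerator_defect T T' $ m = 0"
  shows "blocks_through D (m + card T) T = blocks_through D (m + card T) T'"
proof -
  have coeff: "(\<Sum>B | B \<in> D \<and> S \<subseteq> B. fps_X ^ (card B - card T)) $ m = real (blocks_through D (m + card T) S)"
    if "card S = card T" "S \<subseteq> V" for S
  proof -
    \<comment> \<open>This makes the truncated exponent \<open>card B - card T\<close> determine
      \<open>card B\<close>.\<close>
    have "card T \<le> card B" if "B \<in> D" "S \<subseteq> B" for B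
    proof -
      have "finite B" using that finite_V finite_subset by (auto simp: dual_family_def)
      then show ?thesis using card_mono that \<open>card S = card T\<close> by metis
    qed
    then have eq: "{B. (B \<in> D \<and> S \<subseteq> B) \<and> m = card B - card T} = {B \<in> D. card B = m + card T \<and> S \<subseteq> B}"
      by force
    have "(\<Sum>B | B \<in> D \<and> S \<subseteq> B. fps_X ^ (card B - card T)) $ m
        = (\<Sum>B | B \<in> D \<and> S \<subseteq> B. if m = card B - card T then 1 else 0 :: real)"
      by (simp add: fps_sum_nth)
    also have "\<dots> = real (card {B. (B \<in> D \<and> S \<subseteq> B) \<and> m = card B - card T})"
      by (subst sum.inter_filter[symmetric]) simp_all
    also have "\<dots> = real (blocks_through D (m + card T) S)"
      unfolding eq blocks_through_def ..
    finally show ?thesis .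
  qed
  have "((1 - fps_X) * (1 + fps_X) :: real fps) $ 0 \<noteq> 0" by simp
  then have nz: "(1 - fps_X) * (1 + fps_X) \<noteq> (0 :: real fps)" by (metis fps_zero_nth)
  have const: "(- 2) ^ card T = fps_const ((- 2) ^ card T :: real)"
    by (simp flip: fps_const_power fps_numeral_fps_const fps_const_neg)
  have "real (card F) * (real (blocks_through D (m + card T) T) - real (blocks_through D (m + card T) T')) = 0"
    using arg_cong[OF dual_enumerator_diff[OF assms(1-3) nz smaller], of "\<lambda>f. f $ m"] assms(1-3,5)
    by (simp add: const coeff flip: fps_of_nat)
  moreover have "card F \<noteq> 0" using empty_in by auto
  ultimately show ?thesis by simp
qed

text \<open>The exponents at \<open>a\<close> and \<open>n - a\<close> are swapped, so the two terms
  share the factor \<open>((1 - fps_X) * (1 + fps_X)) ^ (a - card T)\<close>. The cofactor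
  \<open>?G\<close> is the sum or difference of \<open>(1 + fps_X) ^ (n - 2 * a)\<close> and
  \<open>(1 - fps_X) ^ (n - 2 * a)\<close>, according to the parity of
  \<open>card T\<close>.\<close>

lemma enumerator_defect_pair:
  assumes "card T \<le> a" "2 * a < n" "e \<le> 1" "even (card T + e)"
    and "block_diff F T T' (n - a) = (- 1) ^ card T * block_diff F T T' a"
  shows "(\<Sum>u\<in>{a, n - a}. fps_const (block_diff F T T' u) *
      ((1 - fps_X) ^ (u - card T) * (1 + fps_X) ^ (n - u - card T))) $ (2 * w + e)
    = 2 * block_diff F T T' a * (\<Sum>i = 0..w. (- 1) ^ (w - i) * ((real a - real (card T)) gchoose (w - i)) *
        ((real n - 2 * real a) gchoose (2 * i + e)))"
proof -
  let ?c = "block_diff F T T' a" and ?s = "card T" and ?N = "n - 2 * a"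
  let ?Q = "((1 - fps_X) * (1 + fps_X)) ^ (a - ?s) :: real fps"
  let ?G = "(1 + fps_X) ^ ?N + fps_const ((- 1) ^ ?s) * (1 - fps_X) ^ ?N :: real fps"
  have na: "n - (a + ?s) = (a - ?s) + ?N" "n - (n - a + ?s) = a - ?s" "n - a - ?s = (a - ?s) + ?N" "a \<noteq> n - a"
    using assms by auto
  have "(\<Sum>u\<in>{a, n - a}. fps_const (block_diff F T T' u) * ((1 - fps_X) ^ (u - ?s) * (1 + fps_X) ^ (n - u - ?s)))
      = fps_const ?c * ((1 - fps_X) ^ (a - ?s) * (1 + fps_X) ^ ((a - ?s) + ?N))
        + fps_const ((- 1) ^ ?s) * fps_const ?c * ((1 - fps_X) ^ ((a - ?s) + ?N) * (1 + fps_X) ^ (a - ?s))"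
    using na(4) by (simp add: na(1-3) assms(5))
  also have "\<dots> = fps_const ?c * (?Q * ?G)"
    unfolding power_mult_distrib power_add by (simp only: distrib_left distrib_right mult_ac)
  finally have "(\<Sum>u\<in>{a, n - a}. fps_const (block_diff F T T' u) * ((1 - fps_X) ^ (u - ?s) * (1 + fps_X) ^ (n - u - ?s)))
      = fps_const ?c * (?Q * ?G)" .
  then have "(\<Sum>u\<in>{a, n - a}. fps_const (block_diff F T T' u) *
      ((1 - fps_X) ^ (u - ?s) * (1 + fps_X) ^ (n - u - ?s))) $ (2 * w + e) = ?c * (\<Sum>i = 0..w. (- 1) ^ (w - i) * (real (a - ?s) gchoose (w - i)) * ?G $ (2 * i + e))"
    using one_minus_square_power_mult_nth[OF assms(3), of "a - ?s" ?G w] by simp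
  \<comment> \<open>The index has the parity of \<open>card T\<close>, so the two binomials add up
    instead of cancelling.\<close>
  moreover have "?G $ (2 * i + e) = 2 * (real ?N gchoose (2 * i + e))" for i
  proof -
    have "(- 1 :: real) ^ (2 * i + e) * (- 1) ^ ?s = 1"
      using assms(4) by (auto simp: minus_one_power_iff)
    then show ?thesis
      using power_linear_nth[of 1 ?N "2 * i + e"] power_linear_nth[of "- 1" ?N "2 * i + e"]
      by (simp add: algebra_simps flip: fps_const_neg)
  qed
  ultimately show ?thesis
    using assms(1,2) by (simp add: of_nat_diff sum_distrib_left mult_ac)
qed

section \<open>Designs from two or three relevant weights\<close>

text \<open>Weights above \<open>n - t\<close> cannot undercut \<open>a\<close>, because
  \<open>a + t \<le> n\<close>; so the least relevant weight is the minimum distance.\<close>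

lemma min_weight_eq:
  assumes "a \<in> card ` F" "0 < a" "a + t \<le> n"
    and "\<And>u. u \<in> card ` F \<Longrightarrow> 0 < u \<Longrightarrow> u + t \<le> n \<Longrightarrow> a \<le> u"
  shows "Min (card ` (F - {{}})) = a"
proof (rule Min_eqI)
  show "a \<in> card ` (F - {{}})" using assms(1,2) by auto
  fix u assume "u \<in> card ` (F - {{}})"
  then have "u \<in> card ` F" "0 < u" using finite_member by (auto simp: card_gt_0_iff)
  then show "a \<le> u" using assms(3,4) by (cases "u + t \<le> n") auto
qed simp

lemma designs_below_Suc:
  assumes "\<forall>B\<in>D. B \<noteq> {} \<longrightarrow> dp \<le> card B"
    and "dp = t + card {u \<in> card ` F. 0 < u \<and> u + t \<le> n}"
  shows "designs_below (Suc t)"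
  unfolding designs_below_def
proof (intro allI impI)
  fix I I' u
  assume "I \<subseteq> V" "I' \<subseteq> V" "card I' = card I" "card I < Suc t"
  then show "blocks_through F u I = blocks_through F u I'"
    by (intro assmus_mattson[OF assms, of "card I"]) simp_all
qed

text \<open>For sets of size \<open>t + 1\<close> the support of the difference lies in the weights
  counted by the hypothesis and is closed under \<open>u \<mapsto> n - u\<close>.\<close>

lemma block_diff_symmetric:
  assumes "T \<subseteq> V" "T' \<subseteq> V" "card T' = card T" "card T = Suc t" "designs_below (card T)"
    and "block_diff F T T' u \<noteq> 0"
  shows "u \<in> {u \<in> card ` F. 0 < u \<and> u + t \<le> n}" "Suc t \<le> u" "u + Suc t \<le> n"
    "block_diff F T T' (n - u) = (- 1) ^ card T * block_diff F T T' u"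
    "block_diff F T T' (n - u) \<noteq> 0"
proof -
  note supp = block_diff_support[OF assms(1-3,5,6)]
  show "u \<in> {u \<in> card ` F. 0 < u \<and> u + t \<le> n}" "Suc t \<le> u" "u + Suc t \<le> n"
    using supp assms(4) by auto
  have "u \<le> n" using supp by simp
  then show "block_diff F T T' (n - u) = (- 1) ^ card T * block_diff F T T' u"
    using block_diff_complement assms(1-5) by blast
  then show "block_diff F T T' (n - u) \<noteq> 0" using assms(6) by simp
qed

lemma enumerator_defect_eq_sum:
  assumes "T \<subseteq> V" "T' \<subseteq> V" "card T' = card T" "designs_below (card T)"
    and "finite S" "\<And>u. block_diff F T T' u \<noteq> 0 \<Longrightarrow> u \<in> S"
  shows "enumerator_defect T T' = (\<Sum>u\<in>S. fps_const (block_diff F T T' u) *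
    ((1 - fps_X) ^ (u - card T) * (1 + fps_X) ^ (n - u - card T)))"
proof (rule sum.mono_neutral_cong)
  show "fps_const (block_diff F T T' u) * ((1 - fps_X) ^ (u - card T) * (1 + fps_X) ^ (n - u - card T)) = (0 :: real fps)"
    if "u \<in> S - {card T..n - card T}" for u
    using block_diff_support(2,3)[OF assms(1-4), of u] that by fastforce
  show "fps_const (block_diff F T T' u) * ((1 - fps_X) ^ (u - card T) * (1 + fps_X) ^ (n - u - card T)) = (0 :: real fps)"
    if "u \<in> {card T..n - card T} - S" for u
    using assms(6)[of u] that by auto
qed (use assms(5) in auto)

text \<open>Here \<open>card T\<close> is odd, so the difference is antisymmetric and vanishes at
  \<open>n / 2\<close>. A nonzero value therefore sits at a genuine pair \<open>a\<close>,
  \<open>n - a\<close>, which exhausts the two relevant weights and forces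
  \<open>a = d\<close>.\<close>

lemma dual_design_two_weights:
  assumes "\<forall>B\<in>D. B \<noteq> {} \<longrightarrow> dp \<le> card B"
    and "dp = t + card {u \<in> card ` F. 0 < u \<and> u + t \<le> n}"
    and two: "card {u \<in> card ` F. 0 < u \<and> u + t \<le> n} = 2" and "even t"
    and d: "d = Min (card ` (F - {{}}))"
    and vanish: "(\<Sum>i = 0..w. (- 1) ^ (w - i) * ((real d - real (Suc t)) gchoose (w - i)) *
      ((real n - 2 * real d) gchoose (2 * i + 1))) = 0"
    and T: "T \<subseteq> V" "T' \<subseteq> V" "card T = Suc t" "card T' = Suc t"
  shows "blocks_through D (2 * w + 1 + Suc t) T = blocks_through D (2 * w + 1 + Suc t) T'"
proof -
  let ?\<delta> = "block_diff F T T'"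
  let ?W = "{u \<in> card ` F. 0 < u \<and> u + t \<le> n}"
  have cT: "card T' = card T" using T by simp
  have below: "designs_below (card T)" using designs_below_Suc[OF assms(1,2)] T by simp
  note sym = block_diff_symmetric[OF T(1,2) cT T(3) below]
  have "enumerator_defect T T' $ (2 * w + 1) = 0"
  proof (cases "\<exists>u. ?\<delta> u \<noteq> 0")
    case True
    then obtain u where u: "?\<delta> u \<noteq> 0" by blast
    have "?\<delta> (n - u) = - ?\<delta> u" using sym(4)[OF u] T \<open>even t\<close> by simp
    then have "u \<noteq> n - u" using u by auto
    define a where "a = min u (n - u)"
    have a: "?\<delta> a \<noteq> 0" using u sym(5)[OF u] by (simp add: a_def min_def)
    have a2: "2 * a < n" using \<open>u \<noteq> n - u\<close> sym(3)[OF u] by (auto simp: a_def)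
    note aW = sym(1)[OF a] and bW = sym(1)[OF sym(5)[OF a]]
    have "card {a, n - a} = 2" using a2 by simp
    then have W: "?W = {a, n - a}"
      using aW bW two by (intro card_subset_eq[symmetric]) auto
    have "a \<le> u" if "u \<in> card ` F" "0 < u" "u + t \<le> n" for u
    proof -
      have "u \<in> {a, n - a}" using that by (simp flip: W)
      then show ?thesis using a2 by auto
    qed
    then have da: "d = a" unfolding d using aW by (intro min_weight_eq[of a t]) auto
    have "enumerator_defect T T' = (\<Sum>u\<in>{a, n - a}. fps_const (?\<delta> u) *
        ((1 - fps_X) ^ (u - card T) * (1 + fps_X) ^ (n - u - card T)))"
      using sym(1) by (intro enumerator_defect_eq_sum T cT below) (simp_all only: W finite.intros)
    then show ?thesis
      using enumerator_defect_pair[of T a 1 T' w] sym(2,4)[OF a] a2 T \<open>even t\<close> vanish da by simp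
  qed (simp add: fps_sum_nth)
  then show ?thesis using dual_blocks_through_eq[OF T(1,2) cT below, of "2 * w + 1"] T by simp
qed

text \<open>Here \<open>card T\<close> is even, so the difference is symmetric with total zero. Off
  the middle it occupies a pair \<open>a\<close>, \<open>n - a\<close>, and the third weight must
  balance it with the value \<open>- 2 * ?\<delta> a\<close>; without such a pair it is
  zero.\<close>

lemma dual_design_three_weights:
  assumes "\<forall>B\<in>D. B \<noteq> {} \<longrightarrow> dp \<le> card B"
    and "dp = t + card {u \<in> card ` F. 0 < u \<and> u + t \<le> n}"
    and three: "card {u \<in> card ` F. 0 < u \<and> u + t \<le> n} = 3" and "odd t"
    and d: "d = Min (card ` (F - {{}}))"
    and vanish: "(\<Sum>i = 0..w. (- 1) ^ (w - i) * ((real d - real (Suc t)) gchoose (w - i)) *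
      ((real n - 2 * real d) gchoose (2 * i))) + (- 1) ^ (w + 1) * ((real n / 2 - real (Suc t)) gchoose w) = 0"
    and T: "T \<subseteq> V" "T' \<subseteq> V" "card T = Suc t" "card T' = Suc t"
  shows "blocks_through D (2 * w + Suc t) T = blocks_through D (2 * w + Suc t) T'"
proof -
  let ?\<delta> = "block_diff F T T'"
  let ?W = "{u \<in> card ` F. 0 < u \<and> u + t \<le> n}"
  let ?g = "\<lambda>u. fps_const (?\<delta> u) * ((1 - fps_X) ^ (u - card T) * (1 + fps_X) ^ (n - u - card T))"
  have cT: "card T' = card T" using T by simp
  have below: "designs_below (card T)" using designs_below_Suc[OF assms(1,2)] T by simp
  note sym = block_diff_symmetric[OF T(1,2) cT T(3) below]
  \<comment> \<open>The zeroth moment is available because \<open>card T = t + 1\<close> is less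
    than \<open>dp = t + 3\<close>.\<close>
  have total: "(\<Sum>u\<le>n. ?\<delta> u) = 0"
    using block_diff_moment[OF assms(1) T(1,2) cT, of 0] assms(2) three T by simp
  have total_W: "(\<Sum>u\<in>?W. ?\<delta> u) = 0"
    unfolding total[symmetric] using sym(1) by (intro sum.mono_neutral_left) auto
  have "enumerator_defect T T' $ (2 * w) = 0"
  proof (cases "\<exists>u. ?\<delta> u \<noteq> 0 \<and> 2 * u \<noteq> n")
    case True
    then obtain u where u: "?\<delta> u \<noteq> 0" "2 * u \<noteq> n" by blast
    define a where "a = min u (n - u)"
    have a: "?\<delta> a \<noteq> 0" using u sym(5)[OF u(1)] by (simp add: a_def min_def)
    have a2: "2 * a < n" using u(2) sym(3)[OF u(1)] by (auto simp: a_def)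
    note aW = sym(1)[OF a] and bW = sym(1)[OF sym(5)[OF a]]
    have b: "?\<delta> (n - a) = ?\<delta> a" using sym(4)[OF a] T \<open>odd t\<close> by simp
    have "card (?W - {a, n - a}) = 1"
      using aW bW three a2 by (subst card_Diff_subset) auto
    then obtain h where "?W - {a, n - a} = {h}" by (meson card_1_singletonE)
    then have W: "?W = {a, n - a, h}" and h: "h \<noteq> a" "h \<noteq> n - a" "h \<in> ?W" using aW bW by blast+
    have "?\<delta> a + ?\<delta> (n - a) + ?\<delta> h = 0"
      using total_W h(1,2) a2 unfolding W by simp
    then have \<delta>h: "?\<delta> h = - 2 * ?\<delta> a" using b by simp
    then have "?\<delta> h \<noteq> 0" using a by simp
    \<comment> \<open>The reflection of \<open>h\<close> is again a relevant weight; as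
      \<open>h\<close> is neither \<open>a\<close> nor \<open>n - a\<close>, it is its own
      reflection.\<close>
    then have "n - h \<in> {a, n - a, h}" "h + Suc t \<le> n" "Suc t \<le> h"
      using sym(1)[OF sym(5)] sym(2,3) unfolding W by blast+
    then have h2: "2 * h = n" using h a2 by auto
    have "a \<le> u" if "u \<in> card ` F" "0 < u" "u + t \<le> n" for u
    proof -
      have "u \<in> {a, n - a, h}" using that by (simp flip: W)
      then show ?thesis using a2 h2 by auto
    qed
    then have da: "d = a" unfolding d using aW by (intro min_weight_eq[of a t]) auto
    have "enumerator_defect T T' = (\<Sum>u\<in>{a, n - a, h}. ?g u)"
      using sym(1) by (intro enumerator_defect_eq_sum T cT below) (simp_all only: W finite.intros)
    also have "\<dots> = (\<Sum>u\<in>{a, n - a}. ?g u) + ?g h"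
      using h(1,2) a2 by (simp add: algebra_simps)
    also have "n - h = h" using h2 by simp
    then have "?g h = fps_const (?\<delta> h) * (((1 - fps_X) * (1 + fps_X)) ^ (h - card T) * 1)"
      by (simp add: power_mult_distrib)
    finally have "enumerator_defect T T' $ (2 * w) = (\<Sum>u\<in>{a, n - a}. ?g u) $ (2 * w) +
        ?\<delta> h * (((1 - fps_X) * (1 + fps_X)) ^ (h - card T) * (1 :: real fps)) $ (2 * w)"
      by simp
    \<comment> \<open>The middle weight contributes a pure power of \<open>1 - fps_X ^ 2\<close>,
      the source of the extra summand in the vanishing condition.\<close>
    also have "(((1 - fps_X) * (1 + fps_X)) ^ (h - card T) * (1 :: real fps)) $ (2 * w)
        = (- 1) ^ w * (real (h - card T) gchoose w)"
      using one_minus_square_power_mult_nth[of 0 "h - card T" 1 w] by (simp add: mult_delta_right)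
    also have "\<dots> = (- 1) ^ w * ((real n / 2 - real (Suc t)) gchoose w)"
      using \<open>Suc t \<le> h\<close> T h2 by (simp add: of_nat_diff flip: h2)
    also have "(\<Sum>u\<in>{a, n - a}. ?g u) $ (2 * w) = 2 * ?\<delta> a * (\<Sum>i = 0..w. (- 1) ^ (w - i) *
        ((real d - real (Suc t)) gchoose (w - i)) * ((real n - 2 * real d) gchoose (2 * i)))"
      using enumerator_defect_pair[of T a 0 T' w] sym(2,4)[OF a] a2 T \<open>odd t\<close> da by simp
    also have "(\<Sum>i = 0..w. (- 1) ^ (w - i) * ((real d - real (Suc t)) gchoose (w - i)) *
        ((real n - 2 * real d) gchoose (2 * i))) = (- 1) ^ w * ((real n / 2 - real (Suc t)) gchoose w)"
      using vanish by simp
    \<comment> \<open>By \<open>vanish\<close> both contributions contain the same number, with the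
      coefficients \<open>2 * ?\<delta> a\<close> and
      \<open>?\<delta> h = - 2 * ?\<delta> a\<close>.\<close>
    finally show ?thesis by (simp add: \<delta>h)
  next
    case False
    \<comment> \<open>Only the middle weight could carry a nonzero value, and it would then be the
      whole of the total, which is zero.\<close>
    have "?\<delta> u = 0" for u
    proof (rule ccontr)
      assume u: "?\<delta> u \<noteq> 0"
      then have "(\<Sum>v\<in>?W. ?\<delta> v) = (\<Sum>v\<in>{u}. ?\<delta> v)"
      proof (intro sum.mono_neutral_right ballI)
        fix v assume "v \<in> ?W - {u}"
        moreover have "2 * u = n" using False u by blast
        ultimately have "2 * v \<noteq> n" by auto
        then show "?\<delta> v = 0" using False by blast
      qed (use sym(1)[OF u] in auto)
      then show False using total_W u by simp
    qed
    then show ?thesis by (simp add: fps_sum_nth)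
  qed
  then show ?thesis using dual_blocks_through_eq[OF T(1,2) cT below, of "2 * w"] T by simp
qed

end

section \<open>Transfer to vectors\<close>

lemma is_t_designI:
  assumes "\<And>b. b \<in> B \<Longrightarrow> b \<subseteq> X" "\<And>b. b \<in> B \<Longrightarrow> card b = k"
    and "\<And>T T'. T \<subseteq> X \<Longrightarrow> T' \<subseteq> X \<Longrightarrow> card T = s \<Longrightarrow> card T' = s \<Longrightarrow>
      card {b \<in> B. T \<subseteq> b} = card {b \<in> B. T' \<subseteq> b}"
  shows "is_t_design X B s"
  unfolding is_t_design_def
proof (intro conjI)
  \<comment> \<open>Any fixed \<open>s\<close>-subset serves as reference; if none exists, the
    condition on \<open>lam\<close> is vacuous.\<close>
  define T0 where "T0 = (SOME T. T \<subseteq> X \<and> card T = s)"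
  have "card {b \<in> B. T \<subseteq> b} = card {b \<in> B. T0 \<subseteq> b}" if T: "T \<subseteq> X \<and> card T = s" for T
  proof -
    have "T0 \<subseteq> X \<and> card T0 = s" unfolding T0_def using T by (rule someI)
    with T show ?thesis by (intro assms(3)) simp_all
  qed
  then show "\<exists>lam. \<forall>T. T \<subseteq> X \<and> card T = s \<longrightarrow> card {b \<in> B. T \<subseteq> b} = lam" by blast
qed (use assms(1,2) in auto)

lemma supp_indicator: "B \<subseteq> {0..<n} \<Longrightarrow> supp n (\<lambda>i. i \<in> B) = B"
  by (auto simp: supp_def)

lemma supp_eq_empty_iff: "v \<in> bvecs n \<Longrightarrow> supp n v = {} \<longleftrightarrow> v = bzero"
  unfolding supp_def bvecs_def bzero_def fun_eq_iff by (auto simp: not_less[symmetric])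

text \<open>Common 1-positions form the intersection of the supports; conversely, a set in the dual
  family is the support of its indicator function.\<close>

lemma supp_dual_code: "supp n ` dual_code n C = dual_family {0..<n} (supp n ` C)"
proof -
  have orth: "orth n u v \<longleftrightarrow> even (card (supp n u \<inter> supp n v))" for u v
    unfolding orth_def supp_def by (rule arg_cong[of _ _ "\<lambda>X. even (card X)"]) auto
  show ?thesis
  proof
    show "supp n ` dual_code n C \<subseteq> dual_family {0..<n} (supp n ` C)"
      by (auto simp: dual_code_def dual_family_def orth) (auto simp: supp_def)
    show "dual_family {0..<n} (supp n ` C) \<subseteq> supp n ` dual_code n C"
    proof
      fix B assume B: "B \<in> dual_family {0..<n} (supp n ` C)"
      then have "supp n (\<lambda>i. i \<in> B) = B" by (simp add: supp_indicator dual_family_def)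
      moreover from this have "(\<lambda>i. i \<in> B) \<in> dual_code n C"
        using B by (auto simp: dual_code_def dual_family_def orth bvecs_def)
      ultimately show "B \<in> supp n ` dual_code n C" by (metis imageI)
    qed
  qed
qed

lemma min_dist_eq:
  assumes "C \<subseteq> bvecs n"
  shows "min_dist n C = Min (card ` (supp n ` C - {{}}))"
proof -
  have "{wt n c |c. c \<in> C \<and> c \<noteq> bzero} = card ` (supp n ` C - {{}})"
    using assms supp_eq_empty_iff[of _ n] by (auto simp: wt_def image_iff subset_iff)
  then show ?thesis by (simp add: min_dist_def)
qed

lemma binary_code_supp:
  assumes "binary_linear_code n C" "ones n \<in> C"
  shows "binary_code {0..<n} (supp n ` C)"
proof
  show "{} \<in> supp n ` C"
    using assms by (intro image_eqI[of _ _ bzero]) (auto simp: binary_linear_code_def supp_def bzero_def)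
  show "{0..<n} \<in> supp n ` C"
    using assms by (intro image_eqI[of _ _ "ones n"]) (auto simp: supp_def ones_def)
  fix A B assume "A \<in> supp n ` C" "B \<in> supp n ` C"
  then obtain u v where uv: "u \<in> C" "v \<in> C" "A = supp n u" "B = supp n v" by blast
  then have "sym_diff A B = supp n (badd u v)" by (auto simp: supp_def badd_def)
  then show "sym_diff A B \<in> supp n ` C" using uv assms by (auto simp: binary_linear_code_def)
qed (auto simp: supp_def)

lemma design_from_blocks_through:
  assumes "\<And>T T'. T \<subseteq> {0..<n} \<Longrightarrow> T' \<subseteq> {0..<n} \<Longrightarrow> card T = s \<Longrightarrow> card T' = s \<Longrightarrow>
      blocks_through (dual_family {0..<n} (supp n ` C)) k T = blocks_through (dual_family {0..<n} (supp n ` C)) k T'"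
  shows "is_t_design {0..<n} (support_blocks n (dual_code n C) k) s"
proof -
  have blocks: "support_blocks n (dual_code n C) k = {B \<in> dual_family {0..<n} (supp n ` C). card B = k}"
    unfolding supp_dual_code[symmetric] by (auto simp: support_blocks_def weight_class_def wt_def)
  show ?thesis
    unfolding blocks
  proof (rule is_t_designI[where k = k])
    fix T T' assume "T \<subseteq> {0..<n}" "T' \<subseteq> {0..<n}" "card T = s" "card T' = s"
    from assms[OF this] show "card {b \<in> {B \<in> dual_family {0..<n} (supp n ` C). card B = k}. T \<subseteq> b}
        = card {b \<in> {B \<in> dual_family {0..<n} (supp n ` C). card B = k}. T' \<subseteq> b}"
      by (simp add: blocks_through_def conj_assoc)
  qed (auto simp: dual_family_def)
qed

theorem theorem1p2:
  fixes n k d dp t w :: nat and C :: "(nat \<Rightarrow> bool) set"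
  assumes lin: "binary_linear_code n C"
    and dimk: "card C = 2 ^ k"
    and dC: "d = min_dist n C"
    and ones_in: "ones n \<in> C"
    and dpC: "dp = min_dist n (dual_code n C)"
    and tpos: "t > 0"
    and cnt: "int dp - int t = int (card {u. weight_class n C u \<noteq> {} \<and> 0 < u \<and> u + t \<le> n})"
  shows
    "((dp, t) = (4, 2) \<longrightarrow>
        (\<Sum>i = 0..w. (-1) ^ (w - i) * ((real d - 3) gchoose (w - i))
                        * ((real n - 2 * real d) gchoose (2 * i + 1))) = 0 \<longrightarrow>
        is_t_design {0..<n} (support_blocks n (dual_code n C) (2 * w + 4)) 3)
     \<and>
     (((dp, t) = (4, 1) \<or> (dp, t) = (6, 3)) \<longrightarrow>
        (\<Sum>i = 0..w. (-1) ^ (w - i) * ((real d - real (t + 1)) gchoose (w - i))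
                        * ((real n - 2 * real d) gchoose (2 * i)))
          + (-1) ^ (w + 1) * ((real n / 2 - real (t + 1)) gchoose w) = 0 \<longrightarrow>
        is_t_design {0..<n} (support_blocks n (dual_code n C) (2 * w + t + 1)) (t + 1))"
proof -
  let ?F = "supp n ` C"
  let ?W = "{u \<in> card ` ?F. 0 < u \<and> u + t \<le> n}"
  interpret binary_code "{0..<n}" ?F
    using lin ones_in by (rule binary_code_supp)
  have "{u. weight_class n C u \<noteq> {} \<and> 0 < u \<and> u + t \<le> n} = ?W"
    by (auto simp: weight_class_def wt_def)
  then have dp: "dp = t + card {u \<in> card ` ?F. 0 < u \<and> u + t \<le> card {0..<n}}" using cnt by simp
  have d: "d = Min (card ` (?F - {{}}))"
    unfolding dC using lin by (intro min_dist_eq) (simp add: binary_linear_code_def)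
  have "dp = Min (card ` (D - {{}}))"
    unfolding dpC supp_dual_code[symmetric] by (intro min_dist_eq) (auto simp: dual_code_def)
  \<comment> \<open>If the dual code is zero, \<open>dp\<close> is the \<open>Min\<close> of an
    empty set, but then the bound is vacuous.\<close>
  then have dual_dist: "\<forall>B\<in>D. B \<noteq> {} \<longrightarrow> dp \<le> card B" by auto
  show ?thesis
  proof (intro conjI impI)
    assume dp_t: "(dp, t) = (4, 2)"
      and vanish: "(\<Sum>i = 0..w. (-1) ^ (w - i) * ((real d - 3) gchoose (w - i))
        * ((real n - 2 * real d) gchoose (2 * i + 1))) = 0"
    \<comment> \<open>Block sizes are brought into the form coefficient index plus
      \<open>Suc t\<close>; the index \<open>2 * w + 1\<close> is odd like
      \<open>Suc t\<close>.\<close>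
    have nums: "2 * w + 4 = 2 * w + 1 + Suc t" "3 = Suc t" using dp_t by auto
    have "dp = t + 2" "even t" using dp_t by auto
    then have "card {u \<in> card ` ?F. 0 < u \<and> u + t \<le> card {0..<n}} = 2" using dp by linarith
    with \<open>even t\<close> show "is_t_design {0..<n} (support_blocks n (dual_code n C) (2 * w + 4)) 3"
      unfolding nums
      by (intro design_from_blocks_through dual_design_two_weights[OF dual_dist dp _ _ d])
        (use vanish nums(2) dp_t in auto)
  next
    assume dp_t: "(dp, t) = (4, 1) \<or> (dp, t) = (6, 3)"
      and vanish: "(\<Sum>i = 0..w. (-1) ^ (w - i) * ((real d - real (t + 1)) gchoose (w - i))
          * ((real n - 2 * real d) gchoose (2 * i)))
        + (-1) ^ (w + 1) * ((real n / 2 - real (t + 1)) gchoose w) = 0"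
    have nums: "2 * w + t + 1 = 2 * w + Suc t" "t + 1 = Suc t" by auto
    have "dp = t + 3" "odd t" using dp_t by auto
    then have "card {u \<in> card ` ?F. 0 < u \<and> u + t \<le> card {0..<n}} = 3" using dp by linarith
    with \<open>odd t\<close> show "is_t_design {0..<n} (support_blocks n (dual_code n C) (2 * w + t + 1)) (t + 1)"
      unfolding nums
      by (intro design_from_blocks_through dual_design_three_weights[OF dual_dist dp _ _ d])
        (use vanish in \<open>simp_all del: of_nat_Suc add: nums(2)\<close>)
  qed
qed

end
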